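(* Let $u\ge 3$ be an integer, $q=u-1$, and let $\sum'$ denote the sum over pairs of positive integers $(a,b)$ with $a+b=u$ and $a\ge2$. Then for every integer $d\ge0$, \begin{align*} \sum{}'\zeta(a,\bar b,\bar1,1_d)=&\ \zeta(\bar q,1,\bar1,1_d)-\zeta(\bar q,\bar1,1,1_d)+\zeta(\bar u,\bar1,1_d)+\zeta(\bar q,\bar2,1_d)+\sum_{j=1}^d\zeta(\bar q,\bar1,1_{j-1},2,1_{d-j}),\\ \sum{}'\zeta(a,b,\bar1,\bar1,1_d)=&\ \zeta(q,\bar1,1,\bar1,1_d)-\zeta(q,\bar1,\bar1,1,1_d)+\zeta(u,\bar1,\bar1,1_d)+\zeta(q,\bar2,\bar1,1_d)+\zeta(q,\bar1,\bar2,1_d)\\ &+\sum_{j=1}^d\zeta(q,\bar1,\bar1,1_{j-1},2,1_{d-j}). \end{align*}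
   Context: Euler sums: for $(s_1,\dots,s_n)\in\mathbb{N}^n$, $(\mu_1,\dots,\mu_n)\in\{\pm1\}^n$ with $(s_1,\mu_1)\ne(1,1)$, $\zeta(s_1,\dots,s_n;\mu_1,\dots,\mu_n)=\sum_{k_1>\cdots>k_n>0}\frac{\mu_1^{k_1}\cdots\mu_n^{k_n}}{k_1^{s_1}\cdots k_n^{s_n}}$; a bar on an argument $\bar s_j$ means $\mu_j=-1$, no bar means $\mu_j=1$. The string $1_m$ denotes $m$ consecutive unbarred arguments equal to $1$ (empty if $m=0$); an empty sum is $0$. *)

theory Defs
  imports "HOL-Analysis.Analysis"
begin

text \<open>
  An argument list \<open>[(s\<^sub>1, \<mu>\<^sub>1), \<dots>, (s\<^sub>n, \<mu>\<^sub>n)]\<close> encodes \<open>(s\<^sub>1, \<dots>, s\<^sub>n; \<mu>\<^sub>1, \<dots>, \<mu>\<^sub>n)\<close>, where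
  \<open>s\<^sub>j \<ge> 1\<close>, \<open>\<mu>\<^sub>j \<in> {1, -1}\<close> and \<open>(s\<^sub>1, \<mu>\<^sub>1) \<noteq> (1, 1)\<close> are intended.
\<close>

type_synonym euler_arg = "nat \<times> int"

abbreviation plain :: "nat \<Rightarrow> euler_arg" where
  "plain s \<equiv> (s, 1)"

abbreviation bar :: "nat \<Rightarrow> euler_arg" where
  "bar s \<equiv> (s, -1)"

abbreviation ones :: "nat \<Rightarrow> euler_arg list" where
  "ones m \<equiv> replicate m (plain 1)"

definition euler_indices :: "nat \<Rightarrow> nat \<Rightarrow> nat list set" where
  "euler_indices n N = {ks. length ks = n \<and> sorted_wrt (>) ks \<and> set ks \<subseteq> {1..N}}"

text \<open>
  The series is the limit of the truncations \<open>N \<ge> k\<^sub>1 > \<dots> > k\<^sub>n > 0\<close>, because it converges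
  only conditionally when \<open>(s\<^sub>1, \<mu>\<^sub>1) = (1, -1)\<close>, so that an unordered sum would not do.
\<close>

definition euler_sum :: "euler_arg list \<Rightarrow> real" where
  "euler_sum w = lim (\<lambda>N. \<Sum>ks\<in>euler_indices (length w) N.
     \<Prod>i<length w. of_int (snd (w ! i)) ^ (ks ! i) / of_nat (ks ! i) ^ fst (w ! i))"

end

theory Submission
  imports Defs "HOL-Real_Asymp.Real_Asymp"
begin

text \<open>
  Summing a geometric progression, for \<open>k > l\<close>,
  \[ \sum_{a=2}^{q} \frac{1}{k^a l^{q+1-a}}
     = \frac{1}{l^q}\Bigl(\frac{1}{k-l} - \frac{1}{k}\Bigr) - \frac{1}{k^q (k-l)}. \]
  Weighting by \<open>c\<^sub>l\<close> and summing over \<open>k > l\<close>, the first part telescopes in \<open>k\<close> to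
  \<open>\<Sum>\<^sub>l c\<^sub>l H\<^sub>l / l\<^sup>q\<close> with the harmonic number \<open>H\<^sub>l\<close>, and the second part is
  \<open>\<Sum>\<^sub>k k\<^sup>-\<^sup>q \<Sum>\<^sub>l c\<^sub>l / (k - l)\<close>.
  When \<open>c\<close> is a (signed) nested sum, the product with \<open>H\<^sub>l\<close> expands by the
  stuffle product with the argument \<open>1\<close>. The convolution with \<open>1 / (k - l)\<close> is a product of generating
  functions, which are multiple polylogarithms with all weights \<open>1\<close>; it expands by their shuffle
  product, that is, by the product rule for the derivative. The terms occurring in both expansions
  cancel down to the right-hand sides.
\<close>

subsection \<open>Truncated Euler sums\<close>

text \<open>The value 0 at \<open>k = 0\<close> lets all sums start at 0 and gives the generating
  functions below a zero constant coefficient.\<close>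

definition euler_term :: "euler_arg \<Rightarrow> nat \<Rightarrow> real" where
  "euler_term x k = (if k = 0 then 0 else of_int (snd x) ^ k / of_nat k ^ fst x)"

text \<open>The strict bound \<open>k < n\<close> encodes \<open>k\<^sub>1 > k\<^sub>2 > ...\<close>
  under iteration. The inner sum is an arbitrary function, so that products and signed sums can
  stand there too.\<close>

definition nested_sum :: "euler_arg \<Rightarrow> (nat \<Rightarrow> real) \<Rightarrow> nat \<Rightarrow> real" where
  "nested_sum x f n = (\<Sum>k<n. euler_term x k * f k)"

primrec euler_trunc :: "euler_arg list \<Rightarrow> nat \<Rightarrow> real" where
  "euler_trunc [] = (\<lambda>n. 1)"
| "euler_trunc (x # w) = nested_sum x (euler_trunc w)"

lemma euler_term_0 [simp]: "euler_term x 0 = 0"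
  by (simp add: euler_term_def)

lemma nested_sum_0 [simp]: "nested_sum x f 0 = 0"
  by (simp add: nested_sum_def)

lemma nested_sum_Suc [simp]: "nested_sum x f (Suc n) = nested_sum x f n + euler_term x n * f n"
  by (simp add: nested_sum_def)

lemma euler_indices_Suc:
  "euler_indices (Suc n) N = (\<lambda>(k, ks). k # ks) ` (SIGMA k:{1..N}. euler_indices n (k - 1))"
proof (intro equalityI subsetI)
  fix ks assume ks: "ks \<in> euler_indices (Suc n) N"
  then obtain k l where kl: "ks = k # l" "length l = n"
    by (auto simp: euler_indices_def length_Suc_conv)
  show "ks \<in> (\<lambda>(k, ks). k # ks) ` (SIGMA k:{1..N}. euler_indices n (k - 1))"
    using ks kl by (fastforce simp: euler_indices_def intro!: image_eqI[of _ _ "(k, l)"])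
next
  fix ks assume "ks \<in> (\<lambda>(k, ks). k # ks) ` (SIGMA k:{1..N}. euler_indices n (k - 1))"
  then show "ks \<in> euler_indices (Suc n) N"
    by (fastforce simp: euler_indices_def)
qed

lemma finite_euler_indices: "finite (euler_indices n N)"
proof (rule finite_subset)
  show "euler_indices n N \<subseteq> {ks. set ks \<subseteq> {1..N} \<and> length ks = n}"
    by (auto simp: euler_indices_def)
qed (simp add: finite_lists_length_eq)

text \<open>Splitting off the largest index leaves a sum of the same kind with indices at most
  \<open>k - 1\<close>. The argument \<open>Suc N\<close> compensates for the strict bound in
  \<open>nested_sum\<close>.\<close>

lemma sum_euler_indices:
  "(\<Sum>ks\<in>euler_indices (length w) N.
     \<Prod>i<length w. of_int (snd (w ! i)) ^ (ks ! i) / of_nat (ks ! i) ^ fst (w ! i))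
   = euler_trunc w (Suc N)"
proof (induction w arbitrary: N)
  case Nil
  have "euler_indices 0 N = {[]}" by (auto simp: euler_indices_def)
  then show ?case by simp
next
  case (Cons x w)
  let ?t = "\<lambda>w ks. \<Prod>i<length w. of_int (snd (w ! i)) ^ (ks ! i) / of_nat (ks ! i) ^ fst (w ! i) :: real"
  have "(\<Sum>ks\<in>euler_indices (length (x # w)) N. ?t (x # w) ks)
      = (\<Sum>(k, ks)\<in>(SIGMA k:{1..N}. euler_indices (length w) (k - 1)). ?t (x # w) (k # ks))"
    by (simp only: list.size(4) add_Suc_right add_0_right euler_indices_Suc)
       (subst sum.reindex, auto simp: inj_on_def case_prod_unfold)
  also have "\<dots> = (\<Sum>k\<in>{1..N}. \<Sum>ks\<in>euler_indices (length w) (k - 1). ?t (x # w) (k # ks))"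
    by (rule sum.Sigma[symmetric]) (auto simp: finite_euler_indices)
  also have "\<dots> = (\<Sum>k\<in>{1..N}. euler_term x k * euler_trunc w k)"
  proof (rule sum.cong)
    fix k assume k: "k \<in> {1..N}"
    have "(\<Sum>ks\<in>euler_indices (length w) (k - 1). ?t (x # w) (k # ks))
      = euler_term x k * (\<Sum>ks\<in>euler_indices (length w) (k - 1). ?t w ks)"
      using k by (simp add: prod.lessThan_Suc_shift euler_term_def sum_distrib_left del: prod.lessThan_Suc)
    also have "\<dots> = euler_term x k * euler_trunc w k"
      using k by (simp only: Cons.IH) simp
    finally show "(\<Sum>ks\<in>euler_indices (length w) (k - 1). ?t (x # w) (k # ks))
      = euler_term x k * euler_trunc w k" .
  qed simp
  also have "\<dots> = euler_trunc (x # w) (Suc N)"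
    unfolding euler_trunc.simps nested_sum_def
    \<comment> \<open>The range \<open>k < Suc N\<close> differs from \<open>{1..N}\<close> only by
      \<open>k = 0\<close>, where the term vanishes.\<close>
    by (rule sum.mono_neutral_left) (auto simp: Suc_le_eq not_le not_less_eq)
  finally show ?case .
qed

subsection \<open>Polylogarithmic growth and convergence\<close>

lemma harm_le_ln: "n > 0 \<Longrightarrow> harm n \<le> 1 + ln (real n)"
proof (induction n rule: nat_induct_non_zero)
  case (Suc n)
  \<comment> \<open>The sequence \<open>harm n - ln n\<close>, which tends to the Euler-Mascheroni
    constant, decreases from its value 1 at \<open>n = 1\<close>.\<close>
  have "harm (Suc n) - ln (real (Suc n)) \<le> harm n - ln (real n)"
    using euler_mascheroni_sequence_decreasing[of n "Suc n"] Suc.hyps by simp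
  with Suc.IH show ?case by simp
qed (simp add: harm_expand)

lemma harm_add_le: "harm (m + n) \<le> (harm m + harm n :: real)"
proof (induction n)
  case (Suc n)
  have "inverse (real (Suc (m + n))) \<le> inverse (real (Suc n))"
    by (intro le_imp_inverse_le) auto
  with Suc show ?case by (simp only: add_Suc_right harm_Suc)
qed (simp add: harm_expand)

text \<open>For fixed \<open>l\<close> the difference is eventually a sum of \<open>l\<close>
  reciprocals, each tending to 0; shifting the index by \<open>l\<close> removes the truncated
  subtraction.\<close>

lemma harm_diff_tendsto_0: "(\<lambda>N. harm N - harm (N - l) :: real) \<longlonglongrightarrow> 0"
proof (rule LIMSEQ_offset[where k = l])
  have "(\<lambda>N. harm (N + l) - harm N :: real) \<longlonglongrightarrow> 0"
  proof (induction l)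
    case (Suc l)
    have "(\<lambda>N. inverse (real (Suc (N + l)))) \<longlonglongrightarrow> 0" by real_asymp
    from tendsto_add[OF Suc this] show ?case by (simp add: harm_Suc algebra_simps)
  qed simp
  then show "(\<lambda>N. harm (N + l) - harm (N + l - l) :: real) \<longlonglongrightarrow> 0" by simp
qed

text \<open>Growth at most a power of the logarithm. The base \<open>1 + harm k\<close> is at least
  1 everywhere, including \<open>k = 0\<close>, and monotone, so exponents and arguments can be
  enlarged freely.\<close>

definition polylog_bounded :: "(nat \<Rightarrow> real) \<Rightarrow> bool" where
  "polylog_bounded f \<longleftrightarrow> (\<exists>C r. \<forall>k. \<bar>f k\<bar> \<le> C * (1 + harm k) ^ r)"

lemma polylog_boundedE:
  assumes "polylog_bounded f"
  obtains C r where "C \<ge> 0" "\<And>k. \<bar>f k\<bar> \<le> C * (1 + harm k) ^ r"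
proof -
  obtain C r where C: "\<And>k. \<bar>f k\<bar> \<le> C * (1 + harm k) ^ r"
    using assms by (auto simp: polylog_bounded_def)
  have "0 \<le> C" using C[of 0] by (simp add: harm_expand)
  then show ?thesis using C by (rule that)
qed

lemma polylog_bounded_mono:
  "polylog_bounded g \<Longrightarrow> (\<And>k. \<bar>f k\<bar> \<le> \<bar>g k\<bar>) \<Longrightarrow> polylog_bounded f"
  unfolding polylog_bounded_def by (meson order_trans)

lemma polylog_bounded_const: "polylog_bounded (\<lambda>k. c)"
  unfolding polylog_bounded_def by (rule exI[of _ "\<bar>c\<bar>"], rule exI[of _ 0]) simp

lemma polylog_bounded_harm: "polylog_bounded harm"
  unfolding polylog_bounded_def by (rule exI[of _ 1], rule exI[of _ 1]) (simp add: harm_nonneg)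

lemma polylog_bounded_mult:
  assumes "polylog_bounded f" "polylog_bounded g"
  shows "polylog_bounded (\<lambda>k. f k * g k)"
proof -
  obtain C r where C: "C \<ge> 0" "\<And>k. \<bar>f k\<bar> \<le> C * (1 + harm k) ^ r"
    using assms(1) by (rule polylog_boundedE) blast
  obtain D s where D: "D \<ge> 0" "\<And>k. \<bar>g k\<bar> \<le> D * (1 + harm k) ^ s"
    using assms(2) by (rule polylog_boundedE) blast
  have "\<bar>f k * g k\<bar> \<le> (C * D) * (1 + harm k) ^ (r + s)" for k
    using mult_mono[OF C(2)[of k] D(2)[of k]] C(1)
    by (simp add: abs_mult power_add mult_ac harm_nonneg)
  then show ?thesis unfolding polylog_bounded_def by blast
qed

lemma polylog_bounded_add:
  assumes "polylog_bounded f" "polylog_bounded g"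
  shows "polylog_bounded (\<lambda>k. f k + g k)"
proof -
  obtain C r where C: "C \<ge> 0" "\<And>k. \<bar>f k\<bar> \<le> C * (1 + harm k) ^ r"
    using assms(1) by (rule polylog_boundedE) blast
  obtain D s where D: "D \<ge> 0" "\<And>k. \<bar>g k\<bar> \<le> D * (1 + harm k) ^ s"
    using assms(2) by (rule polylog_boundedE) blast
  have "\<bar>f k + g k\<bar> \<le> (C + D) * (1 + harm k) ^ (r + s)" for k
  proof -
    have "(1 + harm k) ^ r \<le> (1 + harm k :: real) ^ (r + s)"
         "(1 + harm k) ^ s \<le> (1 + harm k :: real) ^ (r + s)"
      by (intro power_increasing; simp add: harm_nonneg)+
    then have "C * (1 + harm k) ^ r \<le> C * (1 + harm k) ^ (r + s)"
         "D * (1 + harm k) ^ s \<le> D * (1 + harm k) ^ (r + s)"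
      using C(1) D(1) by (auto intro: mult_left_mono)
    then show ?thesis using C(2)[of k] D(2)[of k] by (simp add: algebra_simps)
  qed
  then show ?thesis unfolding polylog_bounded_def by blast
qed

lemma polylog_bounded_sum:
  "(\<And>i. i \<in> I \<Longrightarrow> polylog_bounded (f i)) \<Longrightarrow> polylog_bounded (\<lambda>k. \<Sum>i\<in>I. f i k)"
  by (induction I rule: infinite_finite_induct)
     (auto intro: polylog_bounded_add polylog_bounded_const)

definition admissible :: "euler_arg \<Rightarrow> bool" where
  "admissible x \<longleftrightarrow> fst x \<ge> 1 \<and> \<bar>snd x\<bar> \<le> 1"

lemma abs_euler_term_le:
  assumes "admissible x" "m \<le> fst x"
  shows "\<bar>euler_term x k\<bar> \<le> 1 / real k ^ m"
proof (cases "k = 0")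
  case False
  have "\<bar>of_int (snd x) :: real\<bar> ^ k \<le> 1"
    using assms by (intro power_le_one) (auto simp: admissible_def)
  moreover have "real k ^ m \<le> real k ^ fst x"
    using False assms by (intro power_increasing) auto
  ultimately show ?thesis
    using False by (auto simp: euler_term_def power_abs intro!: frac_le)
qed simp

text \<open>Since \<open>1 + harm\<close> is monotone, the bound for \<open>f\<close> at
  \<open>n\<close> serves for all \<open>k < n\<close>; the total weight costs one more power. It is
  applied to nested sums and to the convolution with reciprocals.\<close>

lemma polylog_bounded_sum_weighted:
  assumes f: "polylog_bounded f"
    and w: "\<And>n. (\<Sum>k\<in>{1..<n}. \<bar>w n k\<bar>) \<le> harm n"
  shows "polylog_bounded (\<lambda>n. \<Sum>k\<in>{1..<n}. w n k * f k)"
proof -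
  obtain C r where C: "C \<ge> 0" "\<And>k. \<bar>f k\<bar> \<le> C * (1 + harm k) ^ r"
    using f by (rule polylog_boundedE) blast
  have "\<bar>\<Sum>k\<in>{1..<n}. w n k * f k\<bar> \<le> C * (1 + harm n) ^ Suc r" for n
  proof -
    have "\<bar>\<Sum>k\<in>{1..<n}. w n k * f k\<bar> \<le> (\<Sum>k\<in>{1..<n}. \<bar>w n k\<bar> * (C * (1 + harm n) ^ r))"
    proof (rule order_trans[OF sum_abs], rule sum_mono)
      fix k assume "k \<in> {1..<n}"
      then have "\<bar>f k\<bar> \<le> C * (1 + harm n) ^ r"
        by (intro order_trans[OF C(2)] mult_left_mono power_mono add_left_mono harm_mono C(1))
           (auto simp: harm_nonneg add_nonneg_nonneg)
      then show "\<bar>w n k * f k\<bar> \<le> \<bar>w n k\<bar> * (C * (1 + harm n) ^ r)"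
        by (simp add: abs_mult mult_left_mono)
    qed
    also have "\<dots> = (\<Sum>k\<in>{1..<n}. \<bar>w n k\<bar>) * (C * (1 + harm n) ^ r)"
      by (simp add: sum_distrib_right)
    also have "\<dots> \<le> (1 + harm n) * (C * (1 + harm n) ^ r)"
      using w[of n] C(1) by (intro mult_right_mono) (auto simp: harm_nonneg)
    finally show ?thesis by (simp add: mult_ac)
  qed
  then show ?thesis unfolding polylog_bounded_def by blast
qed

lemma sum_inverse_lessThan_le_harm: "(\<Sum>k\<in>{1..<n}. 1 / real k) \<le> harm n"
  unfolding harm_def divide_inverse mult_1_left by (rule sum_mono2) auto

lemma nested_sum_alt: "nested_sum x f n = (\<Sum>k\<in>{1..<n}. euler_term x k * f k)"
  unfolding nested_sum_def by (rule sum.mono_neutral_right) (auto simp: not_le)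

lemma polylog_bounded_nested_sum:
  assumes "admissible x" "polylog_bounded f"
  shows "polylog_bounded (nested_sum x f)"
proof -
  have "(\<Sum>k\<in>{1..<n}. \<bar>euler_term x k\<bar>) \<le> harm n" for n
  proof -
    have "(\<Sum>k\<in>{1..<n}. \<bar>euler_term x k\<bar>) \<le> (\<Sum>k\<in>{1..<n}. 1 / real k)"
      using abs_euler_term_le[OF assms(1), of 1] assms(1)
      by (intro sum_mono) (simp add: admissible_def)
    with sum_inverse_lessThan_le_harm show ?thesis by (rule order_trans[rotated])
  qed
  from polylog_bounded_sum_weighted[OF assms(2) this] show ?thesis
    by (simp add: nested_sum_alt[abs_def])
qed

lemma polylog_bounded_euler_trunc:
  "\<forall>x\<in>set w. admissible x \<Longrightarrow> polylog_bounded (euler_trunc w)"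
  by (induction w) (auto intro: polylog_bounded_const polylog_bounded_nested_sum)

text \<open>The coefficient of \<open>x^k\<close> in the product of \<open>-ln (1 - x)\<close> and
  the generating function of \<open>c\<close>, without the contribution of
  \<open>c 0\<close>.\<close>

definition harm_convolution :: "(nat \<Rightarrow> real) \<Rightarrow> nat \<Rightarrow> real" where
  "harm_convolution c k = (\<Sum>l\<in>{1..<k}. c l / real (k - l))"

lemma polylog_bounded_harm_convolution:
  assumes "polylog_bounded c"
  shows "polylog_bounded (harm_convolution c)"
proof -
  have "(\<Sum>l\<in>{1..<n}. \<bar>1 / real (n - l)\<bar>) \<le> harm n" for n
  proof -
    \<comment> \<open>The reflection of \<open>l\<close> to \<open>n - l\<close> turns the weights
      into plain reciprocals.\<close>
    have "(\<Sum>l\<in>{1..<n}. \<bar>1 / real (n - l)\<bar>) = (\<Sum>l\<in>{1..<n}. 1 / real l)"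
      by (rule sum.reindex_bij_witness[of _ "\<lambda>l. n - l" "\<lambda>l. n - l"]) auto
    with sum_inverse_lessThan_le_harm show ?thesis by simp
  qed
  from polylog_bounded_sum_weighted[OF assms this] show ?thesis
    by (simp add: harm_convolution_def[abs_def])
qed

section \<open>Series with leading exponent at least 2\<close>

definition euler_series :: "euler_arg \<Rightarrow> (nat \<Rightarrow> real) \<Rightarrow> real" where
  "euler_series x f = (\<Sum>k. euler_term x k * f k)"

lemma summable_log_power_over_square:
  "summable (\<lambda>k. (2 + ln (real k)) ^ r / real k ^ 2)"
proof (rule summable_comparison_test_bigo)
  show "summable (\<lambda>k. norm (real k powr - (3/2)))" by (simp add: summable_real_powr_iff)
  \<comment> \<open>The exponent 3/2 still exceeds 1 and leaves a factor \<open>k powr (1/2)\<close>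
    to absorb the power of the logarithm.\<close>
  show "(\<lambda>k. (2 + ln (real k)) ^ r / real k ^ 2) \<in> O(\<lambda>k. real k powr - (3/2))"
    by real_asymp
qed

lemma summable_polylog_over_square:
  assumes "polylog_bounded f"
  shows "summable (\<lambda>k. 1 / real k ^ 2 * \<bar>f k\<bar>)"
proof -
  obtain C r where C: "C \<ge> 0" "\<And>k. \<bar>f k\<bar> \<le> C * (1 + harm k) ^ r"
    using assms by (rule polylog_boundedE) blast
  show ?thesis
  proof (rule summable_comparison_test')
    show "summable (\<lambda>k. C * ((2 + ln (real k)) ^ r / real k ^ 2))"
      by (intro summable_mult summable_log_power_over_square)
    fix k :: nat assume "k \<ge> 1"
    then have "(1 + harm k) ^ r \<le> (2 + ln (real k)) ^ r"
      using harm_le_ln[of k] by (intro power_mono) (auto simp: harm_nonneg add_nonneg_nonneg)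
    then have "\<bar>f k\<bar> \<le> C * (2 + ln (real k)) ^ r"
      using C(2)[of k] mult_left_mono[OF _ C(1)] by (meson order_trans)
    then show "norm (1 / real k ^ 2 * \<bar>f k\<bar>) \<le> C * ((2 + ln (real k)) ^ r / real k ^ 2)"
      by (auto simp: abs_mult intro: divide_right_mono)
  qed
qed

lemma summable_euler_series:
  assumes "admissible x" "fst x \<ge> 2" "polylog_bounded f"
  shows "summable (\<lambda>k. euler_term x k * f k)"
proof (rule summable_comparison_test'[OF summable_polylog_over_square[OF assms(3)]])
  fix k :: nat
  show "norm (euler_term x k * f k) \<le> 1 / real k ^ 2 * \<bar>f k\<bar>"
    using mult_right_mono[OF abs_euler_term_le[OF assms(1,2)], of "\<bar>f k\<bar>" k]
    by (simp add: abs_mult)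
qed

lemma nested_sum_tendsto:
  assumes "admissible x" "fst x \<ge> 2" "polylog_bounded f"
  shows "nested_sum x f \<longlonglongrightarrow> euler_series x f"
  unfolding nested_sum_def[abs_def] euler_series_def
  by (rule summable_LIMSEQ[OF summable_euler_series[OF assms]])

text \<open>This links the limit of truncations to an absolutely convergent series in the leading
  index, on which the rest of the argument operates; every Euler sum of the theorem has leading
  exponent at least 2.\<close>

lemma euler_sum_Cons:
  assumes "admissible x" "fst x \<ge> 2" "\<forall>y\<in>set w. admissible y"
  shows "euler_sum (x # w) = euler_series x (euler_trunc w)"
proof -
  have "(\<lambda>N. euler_trunc (x # w) (Suc N)) \<longlonglongrightarrow> euler_series x (euler_trunc w)"
    unfolding euler_trunc.simps
    using assms by (intro LIMSEQ_Suc nested_sum_tendsto polylog_bounded_euler_trunc) auto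
  then show ?thesis unfolding euler_sum_def sum_euler_indices by (rule limI)
qed

lemma euler_series_add:
  assumes "admissible x" "fst x \<ge> 2" "polylog_bounded f" "polylog_bounded g"
  shows "euler_series x (\<lambda>k. f k + g k) = euler_series x f + euler_series x g"
  using suminf_add[OF summable_euler_series[OF assms(1,2,3)] summable_euler_series[OF assms(1,2,4)]]
  by (simp add: euler_series_def algebra_simps)

lemma euler_series_cmult:
  assumes "admissible x" "fst x \<ge> 2" "polylog_bounded f"
  shows "euler_series x (\<lambda>k. c * f k) = c * euler_series x f"
  using suminf_mult[OF summable_euler_series[OF assms], of c]
  by (simp add: euler_series_def algebra_simps)

lemma euler_series_sum:
  assumes "admissible x" "fst x \<ge> 2" "\<And>i. i \<in> I \<Longrightarrow> polylog_bounded (f i)"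
  shows "euler_series x (\<lambda>k. \<Sum>i\<in>I. f i k) = (\<Sum>i\<in>I. euler_series x (f i))"
  using suminf_sum[of I "\<lambda>i k. euler_term x k * f i k"] summable_euler_series[OF assms(1,2,3)]
  by (simp add: euler_series_def sum_distrib_left)

subsection \<open>Summation over the compositions of a fixed weight\<close>

lemma sum_power_products:
  fixes k l :: real
  assumes "l > 0" "k > l" "q \<ge> 1"
  shows "(\<Sum>a=2..q. 1 / k ^ a * (1 / l ^ (Suc q - a)))
    = 1 / l ^ q * (1 / (k - l) - 1 / k) - 1 / k ^ q * (1 / (k - l))"
  using assms(3)
proof (induction q rule: nat_induct_at_least)
  case base
  then show ?case using assms by (simp add: field_simps)
next
  case (Suc q)
  have "(\<Sum>a=2..Suc q. 1 / k ^ a * (1 / l ^ (Suc (Suc q) - a)))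
      = (\<Sum>a=2..q. 1 / k ^ a * (1 / l ^ (Suc (Suc q) - a))) + 1 / k ^ Suc q * (1 / l)"
    \<comment> \<open>The top summand \<open>a = Suc q\<close> is split off; in the others the
      exponent of \<open>l\<close> has grown by one.\<close>
    using Suc.hyps by (simp add: sum.atLeast_Suc_atMost)
  also have "(\<Sum>a=2..q. 1 / k ^ a * (1 / l ^ (Suc (Suc q) - a)))
      = (\<Sum>a=2..q. 1 / k ^ a * (1 / l ^ (Suc q - a))) * (1 / l)"
    by (simp add: sum_distrib_right sum_divide_distrib Suc_diff_le mult_ac)
  also have "\<dots> = (1 / l ^ q * (1 / (k - l) - 1 / k) - 1 / k ^ q * (1 / (k - l))) * (1 / l)"
    by (simp only: Suc.IH)
  also have "\<dots> + 1 / k ^ Suc q * (1 / l)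
     = 1 / l ^ Suc q * (1 / (k - l) - 1 / k) - 1 / k ^ Suc q * (1 / (k - l))"
  proof -
    \<comment> \<open>This is the partial fraction
      \<open>1 / (l * (k - l)) - 1 / (k * l) = 1 / (k * (k - l))\<close>.\<close>
    have "1 / k ^ q * (1 / (k - l)) * (1 / l) - 1 / k ^ Suc q * (1 / l)
      = 1 / k ^ Suc q * (1 / (k - l))"
      using assms by (simp add: field_simps)
    then show ?thesis by (simp add: algebra_simps)
  qed
  finally show ?case .
qed

text \<open>For \<open>k\<close> running from \<open>l + 1\<close> to \<open>N\<close> the
  differences \<open>1 / (k - l) - 1 / k\<close> add up to
  \<open>harm (N - l) - (harm N - harm l)\<close>. Hence truncation leaves the boundary term
  \<open>harm N - harm (N - l)\<close>.\<close>

lemma sum_nested_plain_truncated: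
  assumes "q \<ge> 1"
  shows "(\<Sum>a=2..q. nested_sum (plain a) (nested_sum (plain (Suc q - a)) c) (Suc N))
    = (\<Sum>l=1..N. 1 / real l ^ q * c l * (harm l - (harm N - harm (N - l))))
      - nested_sum (plain q) (harm_convolution c) (Suc N)"
proof (induction N)
  case 0
  then show ?case by simp
next
  case (Suc N)
  \<comment> \<open>\<open>M\<close> is the new value of the outer index \<open>k\<close>; the
    increments of both sides are compared.\<close>
  define M where "M = Suc N"
  have t: "euler_term (plain a) M = 1 / real M ^ a" for a
    by (simp add: euler_term_def M_def)
  have "(\<Sum>a=2..q. euler_term (plain a) M * nested_sum (plain (Suc q - a)) c M)
      = (\<Sum>a=2..q. \<Sum>l=1..N. 1 / real M ^ a * (1 / real l ^ (Suc q - a)) * c l)"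
    unfolding t nested_sum_alt sum_distrib_left
    by (intro sum.cong) (auto simp: M_def euler_term_def)
  also have "\<dots> = (\<Sum>l=1..N. (\<Sum>a=2..q. 1 / real M ^ a * (1 / real l ^ (Suc q - a))) * c l)"
    by (subst sum.swap) (simp add: sum_distrib_right)
  also have "\<dots> = (\<Sum>l=1..N. (1 / real l ^ q * (1 / (real M - real l) - 1 / real M)
      - 1 / real M ^ q * (1 / (real M - real l))) * c l)"
    using assms by (intro sum.cong refl) (subst sum_power_products, auto simp: M_def)
  also have "\<dots> = (\<Sum>l=1..N. 1 / real l ^ q * c l * (1 / (real M - real l) - 1 / real M))
      - (\<Sum>l=1..N. 1 / real M ^ q * (1 / (real M - real l)) * c l)"
    by (simp add: sum_subtractf[symmetric] algebra_simps)
  also have "(\<Sum>l=1..N. 1 / real M ^ q * (1 / (real M - real l)) * c l)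
      = euler_term (plain q) M * harm_convolution c M"
    unfolding t harm_convolution_def sum_distrib_left
    by (intro sum.cong) (auto simp: M_def of_nat_diff)
  finally have step: "(\<Sum>a=2..q. euler_term (plain a) M * nested_sum (plain (Suc q - a)) c M)
    = (\<Sum>l=1..N. 1 / real l ^ q * c l * (1 / (real M - real l) - 1 / real M))
      - euler_term (plain q) M * harm_convolution c M" .
  \<comment> \<open>The summand \<open>l = M\<close> is zero, because
    \<open>harm M - (harm M - harm 0) = 0\<close>.\<close>
  have "(\<Sum>l=1..M. 1 / real l ^ q * c l * (harm l - (harm M - harm (M - l))))
      = (\<Sum>l=1..N. 1 / real l ^ q * c l * (harm l - (harm M - harm (M - l))))"
    by (simp add: M_def harm_expand)
  also have "\<dots> = (\<Sum>l=1..N. 1 / real l ^ q * c l * (harm l - (harm N - harm (N - l)))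
       + 1 / real l ^ q * c l * (1 / (real M - real l) - 1 / real M))"
  proof (rule sum.cong)
    fix l assume l: "l \<in> {1..N}"
    then have "M - l = Suc (N - l)" by (simp add: M_def Suc_diff_le)
    moreover have "real (Suc (N - l)) = real M - real l" using l by (simp add: M_def of_nat_diff)
    ultimately have "harm (M - l) = harm (N - l) + 1 / (real M - real l)"
      by (simp only: harm_Suc inverse_eq_divide)
    moreover have "harm M = harm N + 1 / real M"
      by (simp only: M_def harm_Suc inverse_eq_divide)
    ultimately show "1 / real l ^ q * c l * (harm l - (harm M - harm (M - l)))
      = 1 / real l ^ q * c l * (harm l - (harm N - harm (N - l)))
       + 1 / real l ^ q * c l * (1 / (real M - real l) - 1 / real M)"
      by (simp add: distrib_left[symmetric] del: times_divide_eq_left times_divide_eq_right)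
  qed simp
  finally have diff: "(\<Sum>l=1..M. 1 / real l ^ q * c l * (harm l - (harm M - harm (M - l))))
    = (\<Sum>l=1..N. 1 / real l ^ q * c l * (harm l - (harm N - harm (N - l))))
     + (\<Sum>l=1..N. 1 / real l ^ q * c l * (1 / (real M - real l) - 1 / real M))"
    by (simp only: sum.distrib)
  show ?case
    unfolding M_def[symmetric] nested_sum_Suc sum.distrib diff step
    using Suc.IH by (simp add: M_def)
qed

text \<open>Each summand tends to 0 for fixed \<open>l\<close>, and subadditivity of
  \<open>harm\<close> gives the summable majorant \<open>\<bar>c l * harm l\<bar> / l^2\<close>
  independent of \<open>N\<close>, so Tannery's theorem applies.\<close>

lemma harm_boundary_tendsto_0:
  assumes "q \<ge> 2" "polylog_bounded c"
  shows "(\<lambda>N. \<Sum>l=1..N. 1 / real l ^ q * c l * (harm N - harm (N - l))) \<longlonglongrightarrow> 0"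
proof -
  \<comment> \<open>Extension by zero beyond \<open>N\<close> makes the finite sum a series over all
    \<open>l\<close>.\<close>
  define a where "a l N = (if l \<in> {1..N} then 1 / real l ^ q * c l * (harm N - harm (N - l)) else 0)"
    for l N
  define M where "M l = 1 / real l ^ 2 * \<bar>c l * harm l\<bar>" for l
  have bound: "norm (a l N) \<le> M l" for l N
  proof (cases "l \<in> {1..N}")
    case True
    have "harm N - harm (N - l) \<le> (harm l :: real)"
      using harm_add_le[of "N - l" l] True by simp
    moreover have "harm (N - l) \<le> (harm N :: real)" by (rule harm_mono) simp
    ultimately have h: "\<bar>harm N - harm (N - l)\<bar> \<le> (harm l :: real)" by simp
    have "real l ^ 2 \<le> real l ^ q" using True assms(1) by (intro power_increasing) auto
    then have "1 / real l ^ q \<le> 1 / real l ^ 2" using True by (intro frac_le) auto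
    then have "(1 / real l ^ q * \<bar>c l\<bar>) * \<bar>harm N - harm (N - l)\<bar> \<le> (1 / real l ^ 2 * \<bar>c l\<bar>) * harm l"
      by (intro mult_mono h) auto
    with True show ?thesis by (simp add: a_def M_def abs_mult)
  next
    case False
    then show ?thesis by (auto simp: a_def M_def)
  qed
  have limit: "(\<lambda>N. a l N) \<longlonglongrightarrow> 0" for l
  proof (cases "l = 0")
    case False
    have "(\<lambda>N. 1 / real l ^ q * c l * (harm N - harm (N - l))) \<longlonglongrightarrow> 0"
      using tendsto_mult_right_zero[OF harm_diff_tendsto_0[of l]] .
    moreover have "\<forall>\<^sub>F N in sequentially. 1 / real l ^ q * c l * (harm N - harm (N - l)) = a l N"
      using eventually_ge_at_top[of l] by eventually_elim (use False in \<open>auto simp: a_def\<close>)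
    ultimately show ?thesis by (rule Lim_transform_eventually)
  qed (simp add: a_def)
  have "summable M"
    unfolding M_def
    by (intro summable_polylog_over_square polylog_bounded_mult assms polylog_bounded_harm)
  then have "(\<lambda>N. suminf (\<lambda>l. a l N)) \<longlonglongrightarrow> suminf (\<lambda>l. 0)"
    using bound
    by (intro tannerys_theorem[OF limit, THEN conjunct2, THEN conjunct2])
       (auto intro!: always_eventually)
  moreover have "suminf (\<lambda>l. a l N) = (\<Sum>l=1..N. 1 / real l ^ q * c l * (harm N - harm (N - l)))" for N
    by (subst suminf_finite[of "{1..N}"]) (auto simp: a_def)
  ultimately show ?thesis by simp
qed

text \<open>Both sides are limits of the truncated identity, whose boundary term disappears.\<close>

lemma sum_nested_plain:
  assumes "q \<ge> 2" "polylog_bounded c"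
  shows "(\<Sum>a=2..q. euler_series (plain a) (nested_sum (plain (Suc q - a)) c))
    = euler_series (plain q) (\<lambda>l. harm l * c l) - euler_series (plain q) (harm_convolution c)"
proof (rule LIMSEQ_unique)
  have adm: "admissible (plain s)" if "s \<ge> 1" for s using that by (simp add: admissible_def)
  show "(\<lambda>N. \<Sum>a=2..q. nested_sum (plain a) (nested_sum (plain (Suc q - a)) c) (Suc N))
    \<longlonglongrightarrow> (\<Sum>a=2..q. euler_series (plain a) (nested_sum (plain (Suc q - a)) c))"
    by (intro tendsto_sum LIMSEQ_Suc nested_sum_tendsto polylog_bounded_nested_sum adm assms) auto
  have "(\<lambda>N. nested_sum (plain q) (\<lambda>l. harm l * c l) (Suc N)
        - (\<Sum>l=1..N. 1 / real l ^ q * c l * (harm N - harm (N - l)))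
        - nested_sum (plain q) (harm_convolution c) (Suc N))
    \<longlonglongrightarrow> euler_series (plain q) (\<lambda>l. harm l * c l) - 0 - euler_series (plain q) (harm_convolution c)"
    using assms
    by (intro tendsto_diff LIMSEQ_Suc nested_sum_tendsto harm_boundary_tendsto_0
        polylog_bounded_harm_convolution polylog_bounded_mult polylog_bounded_harm adm) auto
  moreover have "nested_sum (plain q) (\<lambda>l. harm l * c l) (Suc N)
        - (\<Sum>l=1..N. 1 / real l ^ q * c l * (harm N - harm (N - l)))
     = (\<Sum>l=1..N. 1 / real l ^ q * c l * (harm l - (harm N - harm (N - l))))" for N
    unfolding nested_sum_alt atLeastLessThanSuc_atLeastAtMost sum_subtractf[symmetric]
    by (intro sum.cong) (auto simp: euler_term_def diff_divide_distrib add_divide_distrib algebra_simps)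
  ultimately show "(\<lambda>N. \<Sum>a=2..q. nested_sum (plain a) (nested_sum (plain (Suc q - a)) c) (Suc N))
    \<longlonglongrightarrow> euler_series (plain q) (\<lambda>l. harm l * c l) - euler_series (plain q) (harm_convolution c)"
    using assms(1) by (simp only: sum_nested_plain_truncated diff_0_right)
qed

subsection \<open>Stuffle product with the argument 1\<close>

lemma nested_sum_add: "nested_sum x (\<lambda>k. f k + g k) n = nested_sum x f n + nested_sum x g n"
  by (simp add: nested_sum_def algebra_simps sum.distrib)

lemma nested_sum_cmult: "nested_sum x (\<lambda>k. c * f k) n = c * nested_sum x f n"
  by (simp add: nested_sum_def sum_distrib_left algebra_simps)

lemma nested_sum_sum: "nested_sum x (\<lambda>k. \<Sum>i\<in>I. f i k) n = (\<Sum>i\<in>I. nested_sum x (f i) n)"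
  unfolding nested_sum_def sum_distrib_left by (rule sum.swap)

text \<open>In the double sum the index of the factor \<open>plain 1\<close> is above, equal to or
  below the leading index of the other factor; this yields the three summands.\<close>

lemma stuffle_one_Cons:
  "euler_trunc [plain 1] n * euler_trunc ((s, \<mu>) # w) n
   = euler_trunc (plain 1 # (s, \<mu>) # w) n + euler_trunc ((Suc s, \<mu>) # w) n
     + nested_sum (s, \<mu>) (\<lambda>k. euler_trunc [plain 1] k * euler_trunc w k) n"
proof (induction n)
  case (Suc n)
  have "euler_term (plain 1) n * euler_term (s, \<mu>) n = euler_term (Suc s, \<mu>) n"
    by (simp add: euler_term_def)
  then have "euler_term (plain 1) n * (euler_term (s, \<mu>) n * euler_trunc w n)
      = euler_term (Suc s, \<mu>) n * euler_trunc w n"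
    by (simp only: mult.assoc[symmetric])
  with Suc show ?case by (simp add: algebra_simps)
qed simp

text \<open>A new 1 has \<open>Suc d\<close> places in a string of \<open>d\<close> ones, all giving
  the same word; a coincidence with the \<open>j\<close>-th entry turns that entry into 2.\<close>

lemma stuffle_one_ones:
  "euler_trunc [plain 1] n * euler_trunc (ones d) n
   = real (Suc d) * euler_trunc (ones (Suc d)) n
     + (\<Sum>j=1..d. euler_trunc (ones (j - 1) @ [plain 2] @ ones (d - j)) n)"
proof (induction d arbitrary: n)
  case (Suc d)
  \<comment> \<open>\<open>j = 1\<close> is the coincidence with the leading entry; the other
    positions lie behind a leading 1 and come from the induction hypothesis.\<close>
  have "(\<Sum>j=1..Suc d. euler_trunc (ones (j - 1) @ [plain 2] @ ones (Suc d - j)) n)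
     = euler_trunc (plain 2 # ones d) n
       + (\<Sum>j=1..d. euler_trunc (ones j @ [plain 2] @ ones (d - j)) n)"
    by (subst sum.atLeast_Suc_atMost) (simp_all add: sum.shift_bounds_cl_Suc_ivl del: sum.cl_ivl_Suc)
  also have "(\<Sum>j=1..d. euler_trunc (ones j @ [plain 2] @ ones (d - j)) n)
     = (\<Sum>j=1..d. nested_sum (plain 1) (euler_trunc (ones (j - 1) @ [plain 2] @ ones (d - j))) n)"
  proof (rule sum.cong)
    fix j assume "j \<in> {1..d}"
    then obtain i where "j = Suc i" by (cases j) auto
    then show "euler_trunc (ones j @ [plain 2] @ ones (d - j)) n
       = nested_sum (plain 1) (euler_trunc (ones (j - 1) @ [plain 2] @ ones (d - j))) n"
      by simp
  qed simp
  finally have eq: "(\<Sum>j=1..Suc d. euler_trunc (ones (j - 1) @ [plain 2] @ ones (Suc d - j)) n)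
     = euler_trunc (plain 2 # ones d) n
       + (\<Sum>j=1..d. nested_sum (plain 1) (euler_trunc (ones (j - 1) @ [plain 2] @ ones (d - j))) n)" .
  have "euler_trunc [plain 1] n * euler_trunc (ones (Suc d)) n
    = euler_trunc (ones (Suc (Suc d))) n + euler_trunc (plain 2 # ones d) n
     + nested_sum (plain 1) (\<lambda>k. euler_trunc [plain 1] k * euler_trunc (ones d) k) n"
    using stuffle_one_Cons[of n 1 1 "ones d"] by (simp add: numeral_2_eq_2)
  also have "nested_sum (plain 1) (\<lambda>k. euler_trunc [plain 1] k * euler_trunc (ones d) k) n
    = real (Suc d) * euler_trunc (ones (Suc (Suc d))) n
     + (\<Sum>j=1..d. nested_sum (plain 1) (euler_trunc (ones (j - 1) @ [plain 2] @ ones (d - j))) n)"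
    unfolding Suc.IH nested_sum_add nested_sum_cmult nested_sum_sum by simp
  finally show ?case unfolding eq by (simp add: algebra_simps)
qed simp

text \<open>The new 1 precedes \<open>bar 1\<close>, coincides with it and keeps its sign
  (\<open>bar 2\<close>), or moves on into the ones.\<close>

lemma stuffle_one_bar_ones:
  "euler_trunc [plain 1] n * euler_trunc (bar 1 # ones d) n
   = euler_trunc (plain 1 # bar 1 # ones d) n + euler_trunc (bar 2 # ones d) n
     + real (Suc d) * euler_trunc (bar 1 # plain 1 # ones d) n
     + (\<Sum>j=1..d. euler_trunc (bar 1 # ones (j - 1) @ [plain 2] @ ones (d - j)) n)"
  unfolding stuffle_one_Cons stuffle_one_ones nested_sum_add nested_sum_cmult nested_sum_sum
  by (simp add: numeral_2_eq_2)

lemma stuffle_one_bar_bar_ones: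
  "euler_trunc [plain 1] n * euler_trunc (bar 1 # bar 1 # ones d) n
   = euler_trunc (plain 1 # bar 1 # bar 1 # ones d) n
     + euler_trunc (bar 2 # bar 1 # ones d) n
     + euler_trunc (bar 1 # plain 1 # bar 1 # ones d) n
     + euler_trunc (bar 1 # bar 2 # ones d) n
     + real (Suc d) * euler_trunc (bar 1 # bar 1 # plain 1 # ones d) n
     + (\<Sum>j=1..d. euler_trunc (bar 1 # bar 1 # ones (j - 1) @ [plain 2] @ ones (d - j)) n)"
  unfolding stuffle_one_Cons[of n 1 "-1" "bar 1 # ones d"] stuffle_one_bar_ones
    nested_sum_add nested_sum_cmult nested_sum_sum
  by (simp add: numeral_2_eq_2)

subsection \<open>Shuffle product of generating functions\<close>

unbundle fps_syntax
unbundle no vec_syntax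

text \<open>The one-variable multiple polylogarithm: the power of the variable records the largest
  summation index, and the empty word gives 1.\<close>

definition li_fps :: "euler_arg list \<Rightarrow> real fps" where
  "li_fps w = (case w of [] \<Rightarrow> 1 | x # v \<Rightarrow> Abs_fps (\<lambda>n. euler_term x n * euler_trunc v n))"

definition trunc_fps :: "euler_arg list \<Rightarrow> real fps" where
  "trunc_fps w = Abs_fps (euler_trunc w)"

lemma li_fps_Cons_nth: "li_fps (x # v) $ n = euler_term x n * euler_trunc v n"
  by (simp add: li_fps_def)

text \<open>Multiplication by \<open>1 - fps_X\<close> takes differences of consecutive truncations;
  the factor \<open>fps_X\<close> reflects the strict bound. This transfers identities from
  \<open>li_fps\<close> to \<open>trunc_fps\<close>.\<close>

lemma one_minus_fps_X_mult_trunc_fps: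
  "(1 - fps_X) * trunc_fps (x # v) = fps_X * li_fps (x # v)"
proof (rule fps_ext)
  fix n
  show "((1 - fps_X) * trunc_fps (x # v)) $ n = (fps_X * li_fps (x # v)) $ n"
    by (cases n) (simp_all add: trunc_fps_def li_fps_Cons_nth left_diff_distrib)
qed

text \<open>The differential equation behind iterated integrals. The next sign becomes
  \<open>\<mu> * \<nu>\<close>, so the integrated form at each place is determined by the product of
  all signs up to there.\<close>

lemma li_fps_deriv_Cons_Cons:
  "(1 - fps_const (of_int \<mu>) * fps_X) * fps_deriv (li_fps ((1, \<mu>) # (s, \<nu>) # v))
    = fps_const (of_int \<mu>) * li_fps ((s, \<mu> * \<nu>) # v)"
proof (rule fps_ext)
  fix n
  \<comment> \<open>Differentiation cancels the exponent 1; subtracting \<open>\<mu>\<close> times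
    the preceding coefficient then leaves only the last term of the nested sum.\<close>
  have c: "fps_deriv (li_fps ((1, \<mu>) # (s, \<nu>) # v)) $ n
    = of_int \<mu> ^ Suc n * nested_sum (s, \<nu>) (euler_trunc v) (Suc n)" for n
    by (simp add: li_fps_Cons_nth euler_term_def del: nested_sum_Suc power_Suc)
  have t: "of_int \<mu> ^ n * euler_term (s, \<nu>) n = euler_term (s, \<mu> * \<nu>) n"
    by (simp add: euler_term_def power_mult_distrib)
  have "((1 - fps_const (of_int \<mu>) * fps_X) * fps_deriv (li_fps ((1, \<mu>) # (s, \<nu>) # v))) $ n
    = of_int \<mu> ^ Suc n * (euler_term (s, \<nu>) n * euler_trunc v n)"
  proof (cases n)
    case (Suc m)
    then show ?thesis
      by (simp add: left_diff_distrib mult.assoc c[unfolded One_nat_def] del: fps_deriv_nth)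
         (simp add: algebra_simps)
  qed (simp add: left_diff_distrib mult.assoc c[unfolded One_nat_def] del: fps_deriv_nth)
  also have "\<dots> = of_int \<mu> * (euler_term (s, \<mu> * \<nu>) n * euler_trunc v n)"
    by (simp add: t[symmetric] mult_ac)
  finally show "((1 - fps_const (of_int \<mu>) * fps_X) * fps_deriv (li_fps ((1, \<mu>) # (s, \<nu>) # v))) $ n
    = (fps_const (of_int \<mu>) * li_fps ((s, \<mu> * \<nu>) # v)) $ n"
    by (simp add: li_fps_Cons_nth)
qed

lemma li_fps_deriv_single:
  "(1 - fps_const (of_int \<mu>) * fps_X) * fps_deriv (li_fps [(1, \<mu>)]) = fps_const (of_int \<mu>)"
proof (rule fps_ext)
  fix n
  have c: "fps_deriv (li_fps [(1, \<mu>)]) $ n = of_int \<mu> ^ Suc n" for n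
    by (simp add: li_fps_Cons_nth euler_term_def del: power_Suc)
  show "((1 - fps_const (of_int \<mu>) * fps_X) * fps_deriv (li_fps [(1, \<mu>)])) $ n
    = fps_const (of_int \<mu>) $ n"
    by (cases n) (simp_all add: left_diff_distrib mult.assoc c[unfolded One_nat_def] del: fps_deriv_nth)
qed

text \<open>Uniqueness for the differential equations above: the factor is nonzero and cancels, as
  power series over the reals have no zero divisors.\<close>

lemma fps_eqI_deriv:
  fixes f g :: "real fps"
  assumes "(1 - fps_const c * fps_X) * fps_deriv f = (1 - fps_const c * fps_X) * fps_deriv g"
    and "f $ 0 = g $ 0"
  shows "f = g"
proof -
  have "(1 - fps_const c * fps_X) $ 0 \<noteq> 0" by simp
  then have "1 - fps_const c * fps_X \<noteq> 0" by (metis fps_zero_nth)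
  with assms(1) have "fps_deriv f = fps_deriv g" by simp
  with assms(2) show ?thesis by (simp add: fps_deriv_eq_iff)
qed

text \<open>All cumulative signs equal \<open>\<epsilon>\<close>, so with
  \<open>A = li_fps [(1, \<epsilon>)]\<close> the second factor is in effect
  \<open>A^(d+1) / (d+1)!\<close>. The induction compares derivatives, which lower both words by
  one.\<close>

lemma shuffle_ones:
  "li_fps [(1, \<epsilon>)] * li_fps ((1, \<epsilon>) # ones d)
    = of_nat (d + 2) * li_fps ((1, \<epsilon>) # ones (Suc d))"
proof (induction d)
  case 0
  let ?A = "li_fps [(1, \<epsilon>)]" and ?D = "1 - fps_const (of_int \<epsilon>) * fps_X :: real fps"
  show ?case
  proof (rule fps_eqI_deriv)
    have "?D * fps_deriv (?A * li_fps ((1, \<epsilon>) # ones 0))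
      = ?A * (?D * fps_deriv ?A) + ?A * (?D * fps_deriv ?A)"
      by (simp add: algebra_simps)
    also have "\<dots> = 2 * (fps_const (of_int \<epsilon>) * ?A)"
      unfolding li_fps_deriv_single by simp
    also have "\<dots> = 2 * (?D * fps_deriv (li_fps ((1, \<epsilon>) # ones (Suc 0))))"
      using li_fps_deriv_Cons_Cons[of \<epsilon> 1 1 "[]"] by simp
    finally show "?D * fps_deriv (?A * li_fps ((1, \<epsilon>) # ones 0))
      = ?D * fps_deriv (of_nat (0 + 2) * li_fps ((1, \<epsilon>) # ones (Suc 0)))"
      by (simp add: mult_ac)
  qed (simp add: li_fps_Cons_nth fps_mult_nth)
next
  case (Suc d)
  let ?A = "li_fps [(1, \<epsilon>)]" and ?D = "1 - fps_const (of_int \<epsilon>) * fps_X :: real fps"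
  let ?R = "\<lambda>d. li_fps ((1, \<epsilon>) # ones d)"
  have R: "?D * fps_deriv (?R (Suc d)) = fps_const (of_int \<epsilon>) * ?R d" for d
    using li_fps_deriv_Cons_Cons[of \<epsilon> 1 1 "ones d"] by simp
  show ?case
  proof (rule fps_eqI_deriv)
    have "?D * fps_deriv (?A * ?R (Suc d))
      = (?D * fps_deriv ?A) * ?R (Suc d) + ?A * (?D * fps_deriv (?R (Suc d)))"
      by (simp add: algebra_simps)
    also have "\<dots> = fps_const (of_int \<epsilon>) * ?R (Suc d) + fps_const (of_int \<epsilon>) * (?A * ?R d)"
      unfolding li_fps_deriv_single R by (simp only: mult_ac)
    also have "\<dots> = of_nat (Suc d + 2) * (fps_const (of_int \<epsilon>) * ?R (Suc d))"
      unfolding Suc.IH by (simp add: algebra_simps)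
    also have "\<dots> = of_nat (Suc d + 2) * (?D * fps_deriv (?R (Suc (Suc d))))"
      unfolding R ..
    finally show "?D * fps_deriv (?A * ?R (Suc d))
      = ?D * fps_deriv (of_nat (Suc d + 2) * ?R (Suc (Suc d)))"
      by (simp only: fps_deriv_mult fps_deriv_of_nat mult_zero_left add_0_right add_0_left mult_ac)
  qed (simp add: li_fps_Cons_nth fps_mult_nth)
qed

text \<open>The cumulative signs of the second factor are -1 followed by \<open>d + 1\<close> times
  +1. A letter of sign +1 goes in front of the -1, or into one of \<open>d + 2\<close> places behind
  it; rewriting cumulative signs as ordinary ones gives the two words.\<close>

lemma shuffle_one_bar_bar_ones:
  "li_fps [plain 1] * li_fps (bar 1 # bar 1 # ones d)
   = li_fps (plain 1 # bar 1 # bar 1 # ones d)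
     + of_nat (d + 2) * li_fps (bar 1 # bar 1 # plain 1 # ones d)"
proof -
  let ?A = "li_fps [plain 1]" and ?F = "\<lambda>d. li_fps (bar 1 # bar 1 # ones d)"
  let ?P = "1 + fps_X :: real fps" and ?M = "1 - fps_X :: real fps"
  have dA: "?M * fps_deriv ?A = 1"
    using li_fps_deriv_single[of 1] by simp
  have dF: "?P * fps_deriv (?F d) = - li_fps (plain 1 # ones d)" for d
    using li_fps_deriv_Cons_Cons[of "-1" 1 "-1" "ones d"]
    by (simp add: fps_const_neg[symmetric] del: fps_const_neg)
  have dG: "?M * fps_deriv (li_fps (plain 1 # bar 1 # bar 1 # ones d)) = ?F d"
    using li_fps_deriv_Cons_Cons[of 1 1 "-1" "bar 1 # ones d"] by simp
  have sh: "?A * li_fps (plain 1 # ones d) = of_nat (d + 2) * li_fps (plain 1 # ones (Suc d))"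
    using shuffle_ones[of 1 d] by simp
  have "fps_deriv (?A * ?F d) = fps_deriv (li_fps (plain 1 # bar 1 # bar 1 # ones d)
     + of_nat (d + 2) * ?F (Suc d))"
  proof -
    \<comment> \<open>Two integrated forms occur, so both denominators \<open>1 + fps_X\<close> and
      \<open>1 - fps_X\<close> are cleared.\<close>
    have "?P * ?M * fps_deriv (?A * ?F d)
      = ?P * (?M * fps_deriv ?A) * ?F d + ?M * (?A * (?P * fps_deriv (?F d)))"
      by (simp add: algebra_simps)
    also have "\<dots> = ?P * ?F d - ?M * (?A * li_fps (plain 1 # ones d))"
      unfolding dA dF by simp
    also have "\<dots> = ?P * (?M * fps_deriv (li_fps (plain 1 # bar 1 # bar 1 # ones d)))
        + ?M * (of_nat (d + 2) * (?P * fps_deriv (?F (Suc d))))"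
      unfolding dG dF[of "Suc d"] sh by simp
    also have "\<dots> = ?P * ?M * fps_deriv (li_fps (plain 1 # bar 1 # bar 1 # ones d)
        + of_nat (d + 2) * ?F (Suc d))"
    proof -
      have "p * (m * a) + m * (c * (p * b)) = p * m * (a + c * b)" for p m a b c :: "real fps"
        by (simp add: algebra_simps)
      then show ?thesis
        by (simp only: fps_deriv_add fps_deriv_mult fps_deriv_of_nat mult_zero_left add_0_right)
    qed
    finally have *: "?P * ?M * fps_deriv (?A * ?F d)
      = ?P * ?M * fps_deriv (li_fps (plain 1 # bar 1 # bar 1 # ones d) + of_nat (d + 2) * ?F (Suc d))" .
    have "(?P * ?M) $ 0 \<noteq> 0" by simp
    then have "?P * ?M \<noteq> 0" by (metis fps_zero_nth)
    with * show ?thesis by (metis mult_left_cancel)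
  qed
  then have "?A * ?F d = li_fps (plain 1 # bar 1 # bar 1 # ones d) + of_nat (d + 2) * ?F (Suc d)"
    by (subst (asm) fps_deriv_eq_iff) (simp add: li_fps_Cons_nth fps_mult_nth)
  then show ?thesis by simp
qed


section \<open>Convolutions of truncated sums with reciprocals\<close>

lemma one_minus_fps_X_nonzero: "(1 - fps_X :: real fps) \<noteq> 0"
proof -
  have "(1 - fps_X :: real fps) $ 0 \<noteq> 0" by simp
  then show ?thesis by (metis fps_zero_nth)
qed

lemma li_fps_mult_trunc_fps_nth:
  "(li_fps [(1, \<epsilon>)] * trunc_fps (x # v)) $ k
   = (\<Sum>l\<in>{1..<k}. of_int \<epsilon> ^ (k - l) * euler_trunc (x # v) l / real (k - l))"
proof -
  have "(li_fps [(1, \<epsilon>)] * trunc_fps (x # v)) $ k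
     = (\<Sum>l=0..k. euler_trunc (x # v) l * euler_term (1, \<epsilon>) (k - l))"
    by (subst mult.commute) (simp add: fps_mult_nth trunc_fps_def li_fps_Cons_nth)
  \<comment> \<open>The ends drop out: at \<open>l = 0\<close> the truncation of a nonempty word is
    0, and at \<open>l = k\<close> the value \<open>euler_term (1, \<epsilon>) 0\<close> is
    0.\<close>
  also have "\<dots> = (\<Sum>l\<in>{1..<k}. euler_trunc (x # v) l * euler_term (1, \<epsilon>) (k - l))"
    by (rule sum.mono_neutral_right) (auto simp: not_le not_less le_Suc_eq)
  also have "\<dots> = (\<Sum>l\<in>{1..<k}. of_int \<epsilon> ^ (k - l) * euler_trunc (x # v) l / real (k - l))"
    by (rule sum.cong) (auto simp: euler_term_def)
  finally show ?thesis .
qed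

text \<open>This is \<open>shuffle_ones\<close> for sign -1, multiplied by
  \<open>fps_X / (1 - fps_X)\<close> and read off at coefficient \<open>k\<close>.\<close>

lemma convolution_bar_ones:
  "(\<Sum>l\<in>{1..<k}. (-1) ^ (k - l) * euler_trunc (bar 1 # ones d) l / real (k - l))
   = real (d + 2) * euler_trunc (bar 1 # plain 1 # ones d) k"
proof -
  have "(1 - fps_X) * (li_fps [bar 1] * trunc_fps (bar 1 # ones d))
     = li_fps [bar 1] * ((1 - fps_X) * trunc_fps (bar 1 # ones d))"
    by (simp only: mult_ac)
  also have "\<dots> = fps_X * (li_fps [bar 1] * li_fps (bar 1 # ones d))"
    by (simp only: one_minus_fps_X_mult_trunc_fps mult_ac)
  also have "\<dots> = of_nat (d + 2) * (fps_X * li_fps (bar 1 # ones (Suc d)))"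
    using shuffle_ones[of "-1" d] by (simp only: mult_ac)
  also have "\<dots> = (1 - fps_X) * (of_nat (d + 2) * trunc_fps (bar 1 # ones (Suc d)))"
    by (simp only: one_minus_fps_X_mult_trunc_fps[symmetric] mult_ac)
  finally have "li_fps [bar 1] * trunc_fps (bar 1 # ones d)
     = of_nat (d + 2) * trunc_fps (bar 1 # ones (Suc d))"
    using one_minus_fps_X_nonzero by (metis mult_left_cancel)
  then have "(li_fps [bar 1] * trunc_fps (bar 1 # ones d)) $ k
     = (of_nat (d + 2) * trunc_fps (bar 1 # ones (Suc d))) $ k" by simp
  then show ?thesis
    unfolding li_fps_mult_trunc_fps_nth fps_of_nat[symmetric] fps_mult_left_const_nth
    by (simp add: trunc_fps_def)
qed

lemma convolution_bar_bar_ones: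
  "(\<Sum>l\<in>{1..<k}. euler_trunc (bar 1 # bar 1 # ones d) l / real (k - l))
   = euler_trunc (plain 1 # bar 1 # bar 1 # ones d) k
     + real (d + 2) * euler_trunc (bar 1 # bar 1 # plain 1 # ones d) k"
proof -
  let ?u = "plain 1 # bar 1 # bar 1 # ones d" and ?v = "bar 1 # bar 1 # plain 1 # ones d"
  have "(1 - fps_X) * (li_fps [plain 1] * trunc_fps (bar 1 # bar 1 # ones d))
     = li_fps [plain 1] * ((1 - fps_X) * trunc_fps (bar 1 # bar 1 # ones d))"
    by (simp only: mult_ac)
  also have "\<dots> = fps_X * (li_fps [plain 1] * li_fps (bar 1 # bar 1 # ones d))"
    by (simp only: one_minus_fps_X_mult_trunc_fps mult_ac)
  also have "\<dots> = fps_X * li_fps ?u + of_nat (d + 2) * (fps_X * li_fps ?v)"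
    by (simp only: shuffle_one_bar_bar_ones distrib_left mult_ac)
  also have "\<dots> = (1 - fps_X) * (trunc_fps ?u + of_nat (d + 2) * trunc_fps ?v)"
    by (simp only: one_minus_fps_X_mult_trunc_fps[symmetric] distrib_left mult_ac)
  finally have "li_fps [plain 1] * trunc_fps (bar 1 # bar 1 # ones d)
     = trunc_fps ?u + of_nat (d + 2) * trunc_fps ?v"
    using one_minus_fps_X_nonzero by (metis mult_left_cancel)
  then have "(li_fps [plain 1] * trunc_fps (bar 1 # bar 1 # ones d)) $ k
     = (trunc_fps ?u + of_nat (d + 2) * trunc_fps ?v) $ k" by simp
  then show ?thesis
    unfolding li_fps_mult_trunc_fps_nth fps_of_nat[symmetric] fps_add_nth fps_mult_left_const_nth
    by (simp add: trunc_fps_def)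
qed

unbundle no fps_syntax
unbundle vec_syntax

subsection \<open>The sum formulas\<close>

text \<open>\<open>harm k\<close> includes the index \<open>k\<close>, unlike
  \<open>euler_trunc [plain 1] k\<close>; the extra \<open>1 / k\<close> raises the leading
  exponent.\<close>

lemma euler_series_harm:
  assumes "admissible (s, \<mu>)" "s \<ge> 2" "polylog_bounded f"
  shows "euler_series (s, \<mu>) (\<lambda>k. harm k * f k)
    = euler_series (Suc s, \<mu>) f + euler_series (s, \<mu>) (\<lambda>k. euler_trunc [plain 1] k * f k)"
proof -
  have trunc: "polylog_bounded (euler_trunc [plain 1])"
    by (rule polylog_bounded_euler_trunc) (simp add: admissible_def)
  have harm: "euler_trunc [plain 1] k + 1 / real k = harm k" if "k > 0" for k
    using that
  proof (induction k rule: nat_induct_non_zero)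
    case (Suc k)
    then show ?case by (simp add: harm_Suc euler_term_def inverse_eq_divide)
  qed (simp add: harm_expand)
  have "euler_term (s, \<mu>) k * (harm k * f k)
    = euler_term (Suc s, \<mu>) k * f k + euler_term (s, \<mu>) k * (euler_trunc [plain 1] k * f k)" for k
  proof (cases "k = 0")
    case False
    then have "euler_term (s, \<mu>) k * (1 / real k) = euler_term (Suc s, \<mu>) k"
      by (simp add: euler_term_def mult.commute)
    then show ?thesis
      using False by (simp only: harm[symmetric] distrib_left distrib_right mult.assoc[symmetric])
  qed simp
  then show ?thesis
    unfolding euler_series_def
    using suminf_add[OF summable_euler_series[of "(Suc s, \<mu>)" f]
        summable_euler_series[of "(s, \<mu>)" "\<lambda>k. euler_trunc [plain 1] k * f k"]]
      assms trunc by (simp add: admissible_def polylog_bounded_mult)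
qed

lemma euler_term_plain_mult_sign: "euler_term (plain s) k * ((-1) ^ k * y) = euler_term (bar s) k * y"
  by (simp add: euler_term_def)

lemma nested_sum_bar: "nested_sum (bar s) f = nested_sum (plain s) (\<lambda>k. (-1) ^ k * f k)"
  by (simp add: nested_sum_def fun_eq_iff euler_term_plain_mult_sign)

lemma euler_series_bar: "euler_series (bar s) f = euler_series (plain s) (\<lambda>k. (-1) ^ k * f k)"
  by (simp add: euler_series_def euler_term_plain_mult_sign)

lemma sum_compositions:
  "(\<Sum>(a, b)\<in>{(a, b). a \<ge> 2 \<and> b \<ge> 1 \<and> a + b = Suc q}. g a b) = (\<Sum>a=2..q. g a (Suc q - a))"
  by (rule sum.reindex_bij_witness[of _ "\<lambda>a. (a, Suc q - a)" fst])
     (auto, metis diff_add_inverse)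

lemma sum_bar_bar_ones:
  assumes "q \<ge> 2"
  shows "(\<Sum>a=2..q. euler_sum (plain a # bar (Suc q - a) # bar 1 # ones d))
      = euler_sum (bar q # plain 1 # bar 1 # ones d)
        - euler_sum (bar q # bar 1 # plain 1 # ones d)
        + euler_sum (bar (Suc q) # bar 1 # ones d)
        + euler_sum (bar q # bar 2 # ones d)
        + (\<Sum>j=1..d. euler_sum (bar q # bar 1 # ones (j - 1) @ [plain 2] @ ones (d - j)))"
proof -
  let ?f = "euler_trunc (bar 1 # ones d)"
  \<comment> \<open>The sign of \<open>bar (Suc q - a)\<close> is moved into the weight, so that
    \<open>sum_nested_plain\<close> applies.\<close>
  define c where "c l = (-1) ^ l * ?f l" for l
  have adm: "admissible (plain s)" "admissible (bar s)" if "s \<ge> 1" for s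
    using that by (simp_all add: admissible_def)
  have f: "polylog_bounded ?f" by (rule polylog_bounded_euler_trunc) (simp add: admissible_def)
  then have c: "polylog_bounded c"
    by (rule polylog_bounded_mono) (simp add: c_def abs_mult)
  \<comment> \<open>Writing \<open>(-1)^l = (-1)^k * (-1)^(k - l)\<close>, the first factor turns
    the leading \<open>plain q\<close> into \<open>bar q\<close>, and the second makes the
    convolution a shuffle with \<open>bar 1\<close>.\<close>
  have conv: "harm_convolution c k
      = (-1) ^ k * (real (d + 2) * euler_trunc (bar 1 # plain 1 # ones d) k)" for k
  proof -
    have "harm_convolution c k = (\<Sum>l\<in>{1..<k}. (-1) ^ k * ((-1) ^ (k - l) * ?f l / real (k - l)))"
      unfolding harm_convolution_def c_def
    proof (rule sum.cong)
      fix l assume "l \<in> {1..<k}"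
      then have "k + (k - l) = l + 2 * (k - l)" by auto
      then have "(-1 :: real) ^ k * (-1) ^ (k - l) = (-1) ^ (l + 2 * (k - l))"
        by (simp only: power_add[symmetric])
      then have "(-1 :: real) ^ l = (-1) ^ k * (-1) ^ (k - l)"
        by (simp add: power_add power_mult)
      then show "(-1) ^ l * ?f l / real (k - l) = (-1) ^ k * ((-1) ^ (k - l) * ?f l / real (k - l))"
        by simp
    qed simp
    then show ?thesis by (simp only: sum_distrib_left[symmetric] convolution_bar_ones)
  qed
  have "(\<Sum>a=2..q. euler_sum (plain a # bar (Suc q - a) # bar 1 # ones d))
    = (\<Sum>a=2..q. euler_series (plain a) (nested_sum (plain (Suc q - a)) c))"
    by (intro sum.cong refl, subst euler_sum_Cons)
       (auto simp: admissible_def nested_sum_bar c_def[abs_def])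
  also have "\<dots> = euler_series (plain q) (\<lambda>l. harm l * c l)
      - euler_series (plain q) (harm_convolution c)"
    by (rule sum_nested_plain[OF assms c])
  also have "euler_series (plain q) (\<lambda>l. harm l * c l) = euler_series (bar q) (\<lambda>l. harm l * ?f l)"
    by (simp add: euler_series_bar c_def mult.left_commute)
  also have "\<dots> = euler_series (bar (Suc q)) ?f
      + euler_series (bar q) (\<lambda>l. euler_trunc [plain 1] l * ?f l)"
    using assms by (intro euler_series_harm f adm) auto
  also have "euler_series (bar q) (\<lambda>l. euler_trunc [plain 1] l * ?f l)
      = euler_series (bar q) (euler_trunc (plain 1 # bar 1 # ones d))
        + euler_series (bar q) (euler_trunc (bar 2 # ones d))
        + real (Suc d) * euler_series (bar q) (euler_trunc (bar 1 # plain 1 # ones d))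
        + (\<Sum>j=1..d. euler_series (bar q) (euler_trunc (bar 1 # ones (j - 1) @ [plain 2] @ ones (d - j))))"
    unfolding stuffle_one_bar_ones using assms
    by (simp add: euler_series_add euler_series_cmult euler_series_sum polylog_bounded_add
        polylog_bounded_sum polylog_bounded_mult polylog_bounded_const
        polylog_bounded_euler_trunc admissible_def ball_Un del: euler_trunc.simps)
  also have "euler_series (plain q) (harm_convolution c)
      = real (d + 2) * euler_series (bar q) (euler_trunc (bar 1 # plain 1 # ones d))"
    unfolding conv[abs_def] euler_series_bar[symmetric] using assms
    by (intro euler_series_cmult adm polylog_bounded_euler_trunc) (auto simp: admissible_def)
  \<comment> \<open>The word \<open>bar q # bar 1 # plain 1 # ones d\<close> occurs
    \<open>d + 1\<close> times in the stuffle and \<open>d + 2\<close> times in the shuffle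
    expansion, which leaves the coefficient -1.\<close>
  finally show ?thesis
    using assms
    by (simp add: euler_sum_Cons[of "bar q"] euler_sum_Cons[of "bar (Suc q)"] admissible_def
        ball_Un algebra_simps del: euler_trunc.simps)
qed
lemma sum_plain_bar_bar_ones:
  assumes "q \<ge> 2"
  shows "(\<Sum>a=2..q. euler_sum (plain a # plain (Suc q - a) # bar 1 # bar 1 # ones d))
      = euler_sum (plain q # bar 1 # plain 1 # bar 1 # ones d)
        - euler_sum (plain q # bar 1 # bar 1 # plain 1 # ones d)
        + euler_sum (plain (Suc q) # bar 1 # bar 1 # ones d)
        + euler_sum (plain q # bar 2 # bar 1 # ones d)
        + euler_sum (plain q # bar 1 # bar 2 # ones d)
        + (\<Sum>j=1..d. euler_sum (plain q # bar 1 # bar 1 # ones (j - 1) @ [plain 2] @ ones (d - j)))"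
proof -
  let ?c = "euler_trunc (bar 1 # bar 1 # ones d)"
  have adm: "admissible (plain s)" if "s \<ge> 1" for s
    using that by (simp add: admissible_def)
  have c: "polylog_bounded ?c" by (rule polylog_bounded_euler_trunc) (simp add: admissible_def)
  have "(\<Sum>a=2..q. euler_sum (plain a # plain (Suc q - a) # bar 1 # bar 1 # ones d))
    = (\<Sum>a=2..q. euler_series (plain a) (nested_sum (plain (Suc q - a)) ?c))"
    by (intro sum.cong refl, subst euler_sum_Cons) (auto simp: admissible_def)
  also have "\<dots> = euler_series (plain q) (\<lambda>l. harm l * ?c l)
      - euler_series (plain q) (harm_convolution ?c)"
    by (rule sum_nested_plain[OF assms c])
  also have "euler_series (plain q) (\<lambda>l. harm l * ?c l) = euler_series (plain (Suc q)) ?c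
      + euler_series (plain q) (\<lambda>l. euler_trunc [plain 1] l * ?c l)"
    using assms by (intro euler_series_harm c adm) auto
  also have "euler_series (plain q) (\<lambda>l. euler_trunc [plain 1] l * ?c l)
      = euler_series (plain q) (euler_trunc (plain 1 # bar 1 # bar 1 # ones d))
        + euler_series (plain q) (euler_trunc (bar 2 # bar 1 # ones d))
        + euler_series (plain q) (euler_trunc (bar 1 # plain 1 # bar 1 # ones d))
        + euler_series (plain q) (euler_trunc (bar 1 # bar 2 # ones d))
        + real (Suc d) * euler_series (plain q) (euler_trunc (bar 1 # bar 1 # plain 1 # ones d))
        + (\<Sum>j=1..d. euler_series (plain q)
             (euler_trunc (bar 1 # bar 1 # ones (j - 1) @ [plain 2] @ ones (d - j))))"
    unfolding stuffle_one_bar_bar_ones using assms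
    by (simp add: euler_series_add euler_series_cmult euler_series_sum polylog_bounded_add
        polylog_bounded_sum polylog_bounded_mult polylog_bounded_const
        polylog_bounded_euler_trunc admissible_def ball_Un del: euler_trunc.simps)
  also have "euler_series (plain q) (harm_convolution ?c)
      = euler_series (plain q) (euler_trunc (plain 1 # bar 1 # bar 1 # ones d))
        + real (d + 2) * euler_series (plain q) (euler_trunc (bar 1 # bar 1 # plain 1 # ones d))"
    unfolding harm_convolution_def[abs_def] convolution_bar_bar_ones using assms
    by (simp add: euler_series_add euler_series_cmult polylog_bounded_mult polylog_bounded_const
        polylog_bounded_euler_trunc admissible_def del: euler_trunc.simps)
  \<comment> \<open>The word beginning \<open>plain q # plain 1\<close> occurs once in either
    expansion and cancels; the word with \<open>plain 1\<close> after two bars keeps the coefficient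
    \<open>(d + 1) - (d + 2) = -1\<close>.\<close>
  finally show ?thesis
    using assms
    by (simp add: euler_sum_Cons[of "plain q"] euler_sum_Cons[of "plain (Suc q)"] admissible_def
        ball_Un algebra_simps del: euler_trunc.simps)
qed

theorem theorem6p1:
  fixes u q d :: nat
  assumes "u \<ge> 3" and "q = u - 1"
  shows
    "(\<Sum>(a, b)\<in>{(a, b). a \<ge> 2 \<and> b \<ge> 1 \<and> a + b = u}.
        euler_sum ([plain a, bar b, bar 1] @ ones d))
      = euler_sum ([bar q, plain 1, bar 1] @ ones d)
        - euler_sum ([bar q, bar 1, plain 1] @ ones d)
        + euler_sum ([bar u, bar 1] @ ones d)
        + euler_sum ([bar q, bar 2] @ ones d)
        + (\<Sum>j=1..d. euler_sum ([bar q, bar 1] @ ones (j - 1) @ [plain 2] @ ones (d - j)))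
     \<and>
     (\<Sum>(a, b)\<in>{(a, b). a \<ge> 2 \<and> b \<ge> 1 \<and> a + b = u}.
        euler_sum ([plain a, plain b, bar 1, bar 1] @ ones d))
      = euler_sum ([plain q, bar 1, plain 1, bar 1] @ ones d)
        - euler_sum ([plain q, bar 1, bar 1, plain 1] @ ones d)
        + euler_sum ([plain u, bar 1, bar 1] @ ones d)
        + euler_sum ([plain q, bar 2, bar 1] @ ones d)
        + euler_sum ([plain q, bar 1, bar 2] @ ones d)
        + (\<Sum>j=1..d. euler_sum ([plain q, bar 1, bar 1] @ ones (j - 1) @ [plain 2] @ ones (d - j)))"
proof -
  have u: "u = Suc q" and q: "q \<ge> 2" using assms by auto
  show ?thesis
    using sum_bar_bar_ones[OF q, of d] sum_plain_bar_bar_ones[OF q, of d]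
    unfolding u sum_compositions append_Cons append_Nil by (rule conjI)
qed

end
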